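(* Let $n\ge2$. Every element $\beta\in C_n$ can be written in the form $$\beta=\beta_1\beta_2\cdots\beta_{n-1}\pi_\beta,$$ where $\pi_\beta$ is a permutation automorphism and each $\beta_j$ belongs to the subgroup $D_j$, $j=1,\dots,n-1$.
   Context: $F_n$ is the free group on $x_1,\dots,x_n$. Products of automorphisms are read from left to right. $C_n\le\mathrm{Aut}(F_n)$ is the group of conjugating automorphisms: those sending each $x_i$ to $f_i^{-1}x_{\pi(i)}f_i$ for some $f_i\in F_n$ and some permutation $\pi\in S_n$. A permutation automorphism is one of the form $x_i\mapsto x_{\pi(i)}$, $\pi\in S_n$. For $1\le i\ne j\le n$, $\varepsilon_{ij}$ is the automorphism $x_i\mapsto x_j^{-1}x_ix_j$, $x_l\mapsto x_l$ for $l\neq i$. For $i=1,\dots,n-1$, $D_i=\langle \varepsilon_{i+1,1},\ldots,\varepsilon_{i+1,i},\varepsilon_{1,i+1},\ldots,\varepsilon_{i,i+1}\rangle$. *)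

theory Defs
  imports
    "HOL-Algebra.Bij"
    "HOL-Algebra.Generated_Groups"
    "HOL-Combinatorics.Permutations"
begin

section \<open>The free group on a set\<close>

text \<open>
  A letter is a pair of a generator and a sign: \<open>(x, True)\<close> stands for the generator
  \<open>x\<close> itself and \<open>(x, False)\<close> for its formal inverse. The elements of the free group are
  the reduced words; the product is concatenation followed by free reduction.
\<close>

type_synonym 'a letter = "'a \<times> bool"

definition flip :: "'a letter \<Rightarrow> 'a letter" where
  "flip p = (fst p, \<not> snd p)"

definition reduced :: "'a letter list \<Rightarrow> bool" where
  "reduced = successively (\<lambda>p q. q \<noteq> flip p)"

fun push :: "'a letter \<Rightarrow> 'a letter list \<Rightarrow> 'a letter list" where
  "push p [] = [p]"
| "push p (q # w) = (if q = flip p then w else p # q # w)"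

definition free_group :: "'a set \<Rightarrow> 'a letter list monoid" where
  "free_group X =
    \<lparr>carrier = {w. fst ` set w \<subseteq> X \<and> reduced w},
     monoid.mult = \<lambda>u v. foldr push u v,
     one = []\<rparr>"

definition gen :: "'a \<Rightarrow> 'a letter list" where
  "gen x = [(x, True)]"

text \<open>The homomorphism to \<open>G\<close> that extends a map \<open>f\<close> of the basis.\<close>

definition free_lift :: "'a set \<Rightarrow> ('b, 'c) monoid_scheme \<Rightarrow> ('a \<Rightarrow> 'b) \<Rightarrow> 'a letter list \<Rightarrow> 'b" where
  "free_lift X G f = restrict
    (\<lambda>w. foldr (\<lambda>(x, s) g. (if s then f x else inv\<^bsub>G\<^esub> f x) \<otimes>\<^bsub>G\<^esub> g) w \<one>\<^bsub>G\<^esub>)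
    (carrier (free_group X))"

lemma flip_flip [simp]: "flip (flip p) = p"
  by (simp add: flip_def)

lemma fst_flip [simp]: "fst (flip p) = fst p"
  by (simp add: flip_def)

lemma flip_neq [simp]: "flip p \<noteq> p" "p \<noteq> flip p"
  by (auto simp: flip_def prod_eq_iff)

lemma reduced_Nil [simp]: "reduced []"
  by (simp add: reduced_def)

lemma reduced_Cons: "reduced (p # w) \<longleftrightarrow> (w = [] \<or> hd w \<noteq> flip p) \<and> reduced w"
  by (auto simp: reduced_def successively_Cons)

lemma reduced_push: "reduced w \<Longrightarrow> reduced (push p w)"
  by (cases w) (auto simp: reduced_Cons)

lemma reduced_foldr_push: "reduced v \<Longrightarrow> reduced (foldr push u v)"
  by (induction u) (auto simp: reduced_push)

lemma fst_push: "fst ` set (push p w) \<subseteq> insert (fst p) (fst ` set w)"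
  by (cases w) auto

lemma fst_foldr_push: "fst ` set (foldr push u v) \<subseteq> fst ` set u \<union> fst ` set v"
proof (induction u)
  case (Cons p u)
  have "fst ` set (foldr push (p # u) v) \<subseteq> insert (fst p) (fst ` set (foldr push u v))"
    using fst_push[of p "foldr push u v"] by simp
  also have "\<dots> \<subseteq> insert (fst p) (fst ` set u \<union> fst ` set v)"
    using Cons.IH by blast
  finally show ?case by simp
qed simp

lemma push_flip: "reduced w \<Longrightarrow> push p (push (flip p) w) = w"
proof (cases w)
  case (Cons q w')
  assume "reduced w"
  then show ?thesis using Cons by (cases w') (auto simp: reduced_Cons)
qed simp

lemma push_reduced: "reduced (p # w) \<Longrightarrow> push p w = p # w"
  by (cases w) (auto simp: reduced_Cons)

lemma foldr_push_push:
  assumes "reduced w"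
  shows "foldr push (push p u) w = push p (foldr push u w)"
proof (cases u)
  case (Cons q u')
  then show ?thesis
    using push_flip[OF reduced_foldr_push[OF assms], of p u'] by auto
qed simp

lemma foldr_push_assoc:
  "reduced w \<Longrightarrow> foldr push (foldr push u v) w = foldr push u (foldr push v w)"
  by (induction u) (auto simp: foldr_push_push)

lemma foldr_push_Nil: "reduced u \<Longrightarrow> foldr push u [] = u"
  by (induction u) (auto simp: reduced_Cons push_reduced)

lemma foldr_push_inverse:
  "reduced w \<Longrightarrow> foldr push (rev (map flip u)) (foldr push u w) = w"
proof (induction u)
  case (Cons p u)
  then show ?case
    using push_flip[OF reduced_foldr_push[of w u], of "flip p"] by simp
qed simp

lemma group_free_group: "group (free_group X)"
proof (rule groupI)
  fix u v assume "u \<in> carrier (free_group X)" "v \<in> carrier (free_group X)"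
  then show "u \<otimes>\<^bsub>free_group X\<^esub> v \<in> carrier (free_group X)"
    using order_trans[OF fst_foldr_push[of u v], of X]
    by (simp add: free_group_def reduced_foldr_push)
next
  fix u assume u: "u \<in> carrier (free_group X)"
  let ?v = "foldr push (rev (map flip u)) []"
  have "fst ` set ?v \<subseteq> X"
    using fst_foldr_push[of "rev (map flip u)" "[]"] u by (fastforce simp: free_group_def)
  moreover have "foldr push ?v u = []"
    using foldr_push_assoc[of u "rev (map flip u)" "[]"] foldr_push_inverse[of "[]" u] u
    by (simp add: free_group_def foldr_push_Nil)
  ultimately show "\<exists>v\<in>carrier (free_group X). v \<otimes>\<^bsub>free_group X\<^esub> u = \<one>\<^bsub>free_group X\<^esub>"
    by (intro bexI[of _ ?v]) (auto simp: free_group_def reduced_foldr_push)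
qed (auto simp: free_group_def foldr_push_assoc)

lemma gen_closed: "x \<in> X \<Longrightarrow> gen x \<in> carrier (free_group X)"
  by (simp add: gen_def free_group_def reduced_Cons)

lemma inv_gen: "x \<in> X \<Longrightarrow> inv\<^bsub>free_group X\<^esub> gen x = [(x, False)]"
  by (rule group.inv_equality[OF group_free_group])
    (auto simp: gen_def free_group_def reduced_Cons flip_def)

lemma free_lift_hom:
  assumes G: "group G" and f: "f \<in> X \<rightarrow> carrier G"
  shows "free_lift X G f \<in> hom (free_group X) G"
proof -
  interpret group G by fact
  define l where "l = (\<lambda>p. if snd p then f (fst p) else inv\<^bsub>G\<^esub> f (fst p))"
  define h where "h = (\<lambda>w. foldr (\<lambda>p g. l p \<otimes>\<^bsub>G\<^esub> g) w \<one>\<^bsub>G\<^esub>)"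
  have h_Cons: "h (p # w) = l p \<otimes>\<^bsub>G\<^esub> h w" and h_Nil: "h [] = \<one>\<^bsub>G\<^esub>" for p w
    by (simp_all add: h_def)
  have l: "l p \<in> carrier G" if "fst p \<in> X" for p
    using f that by (auto simp: l_def)
  have hc: "h w \<in> carrier G" if "fst ` set w \<subseteq> X" for w
    using that by (induction w) (auto simp: h_Cons h_Nil l)
  have l_flip: "l p \<otimes>\<^bsub>G\<^esub> (l (flip p) \<otimes>\<^bsub>G\<^esub> g) = g" if "fst p \<in> X" "g \<in> carrier G" for p g
    using f that by (auto simp: l_def flip_def m_assoc[symmetric] Pi_iff)
  have h_push: "h (push p w) = l p \<otimes>\<^bsub>G\<^esub> h w" if "fst p \<in> X" "fst ` set w \<subseteq> X" for p w
    using that by (cases w) (auto simp: h_Cons h_Nil l_flip hc)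
  have h_mult: "h (foldr push u v) = h u \<otimes>\<^bsub>G\<^esub> h v"
    if "fst ` set u \<subseteq> X" "fst ` set v \<subseteq> X" for u v
    using that(1)
  proof (induction u)
    case (Cons p u)
    have "fst ` set (foldr push u v) \<subseteq> X"
      using order_trans[OF fst_foldr_push[of u v], of X] Cons.prems that(2) by simp
    with Cons that(2) show ?case by (auto simp: h_Cons h_push m_assoc l hc)
  qed (simp add: h_Nil hc that(2))
  have eq: "free_lift X G f = restrict h (carrier (free_group X))"
    by (simp add: free_lift_def h_def l_def case_prod_unfold)
  show ?thesis
    unfolding eq
  proof (rule homI)
    fix u v assume uv: "u \<in> carrier (free_group X)" "v \<in> carrier (free_group X)"
    then have "u \<otimes>\<^bsub>free_group X\<^esub> v \<in> carrier (free_group X)"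
      by (rule monoid.m_closed[OF group.is_monoid[OF group_free_group]])
    with uv show "restrict h (carrier (free_group X)) (u \<otimes>\<^bsub>free_group X\<^esub> v) =
        restrict h (carrier (free_group X)) u \<otimes>\<^bsub>G\<^esub> restrict h (carrier (free_group X)) v"
      by (simp, simp add: free_group_def h_mult)
  qed (auto simp: free_group_def hc)
qed

lemma free_lift_gen:
  assumes "group G" "x \<in> X" "f x \<in> carrier G"
  shows "free_lift X G f (gen x) = f x"
  using assms gen_closed[OF assms(2)]
  by (simp add: free_lift_def gen_def group.is_monoid monoid.r_one)

lemma free_group_hom_eqI:
  assumes G: "group G" and h: "h \<in> hom (free_group X) G" and k: "k \<in> hom (free_group X) G"
    and eq: "\<And>x. x \<in> X \<Longrightarrow> h (gen x) = k (gen x)"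
    and w: "w \<in> carrier (free_group X)"
  shows "h w = k w"
proof -
  let ?F = "free_group X"
  interpret h: group_hom ?F G h
    using G h by (simp add: group_hom_def group_hom_axioms_def group_free_group)
  interpret k: group_hom ?F G k
    using G k by (simp add: group_hom_def group_hom_axioms_def group_free_group)
  have letter: "[p] \<in> carrier ?F \<and> h [p] = k [p]" if "fst p \<in> X" for p
  proof (cases p)
    case (Pair x s)
    have x: "x \<in> X" using that Pair by simp
    show ?thesis
    proof (cases s)
      case True
      then show ?thesis using eq[OF x] gen_closed[OF x] Pair by (simp add: gen_def)
    next
      case False
      then have "[p] = inv\<^bsub>?F\<^esub> gen x" using inv_gen[OF x] Pair by simp
      then show ?thesis using eq[OF x] gen_closed[OF x] by simp
    qed
  qed
  show ?thesis using w
  proof (induction w)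
    case Nil
    then show ?case using h.hom_one k.hom_one by (simp add: free_group_def)
  next
    case (Cons p w)
    then have w: "w \<in> carrier ?F" and p: "fst p \<in> X"
      by (auto simp: free_group_def reduced_Cons)
    have "p # w = [p] \<otimes>\<^bsub>?F\<^esub> w"
      using Cons.prems by (simp add: free_group_def push_reduced)
    then show ?case using Cons.IH[OF w] letter[OF p] w by simp
  qed
qed

section \<open>Automorphisms of the free group\<close>

abbreviation F :: "nat \<Rightarrow> nat letter list monoid" where
  "F n \<equiv> free_group {1..n}"

text \<open>
  Products of automorphisms are read from left to right, so that \<open>\<phi>\<close> is applied first in the
  product of \<open>\<phi>\<close> and \<open>\<psi>\<close>; \<^const>\<open>AutoGroup\<close> has the opposite convention.
\<close>

definition Aut :: "('a, 'b) monoid_scheme \<Rightarrow> ('a \<Rightarrow> 'a) monoid" where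
  "Aut G = AutoGroup G \<lparr>monoid.mult := \<lambda>\<phi> \<psi>. \<psi> \<otimes>\<^bsub>AutoGroup G\<^esub> \<phi>\<rparr>"

definition C :: "nat \<Rightarrow> (nat letter list \<Rightarrow> nat letter list) set" where
  "C n = {\<phi> \<in> carrier (Aut (F n)). \<exists>\<pi> f. \<pi> permutes {1..n} \<and>
    (\<forall>i\<in>{1..n}. f i \<in> carrier (F n) \<and>
      \<phi> (gen i) = inv\<^bsub>F n\<^esub> f i \<otimes>\<^bsub>F n\<^esub> gen (\<pi> i) \<otimes>\<^bsub>F n\<^esub> f i)}"

definition perm_autos :: "nat \<Rightarrow> (nat letter list \<Rightarrow> nat letter list) set" where
  "perm_autos n = {\<phi> \<in> carrier (Aut (F n)). \<exists>\<pi>. \<pi> permutes {1..n} \<and>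
    (\<forall>i\<in>{1..n}. \<phi> (gen i) = gen (\<pi> i))}"

definition \<epsilon> :: "nat \<Rightarrow> nat \<Rightarrow> nat \<Rightarrow> nat letter list \<Rightarrow> nat letter list" where
  "\<epsilon> n i j = free_lift {1..n} (F n)
    (\<lambda>l. if l = i then inv\<^bsub>F n\<^esub> gen j \<otimes>\<^bsub>F n\<^esub> gen i \<otimes>\<^bsub>F n\<^esub> gen j else gen l)"

definition D :: "nat \<Rightarrow> nat \<Rightarrow> (nat letter list \<Rightarrow> nat letter list) set" where
  "D n i = generate (Aut (F n)) ({\<epsilon> n (i + 1) j |j. j \<in> {1..i}} \<union> {\<epsilon> n j (i + 1) |j. j \<in> {1..i}})"

lemma carrier_Aut: "carrier (Aut G) = auto G"
  by (simp add: Aut_def AutoGroup_def)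

lemma mult_Aut:
  assumes "\<phi> \<in> carrier (Aut G)" "\<psi> \<in> carrier (Aut G)"
  shows "\<phi> \<otimes>\<^bsub>Aut G\<^esub> \<psi> = (\<lambda>x\<in>carrier G. \<psi> (\<phi> x))"
  using assms by (auto simp: Aut_def AutoGroup_def BijGroup_def auto_def compose_def)

lemma group_Aut:
  assumes "group G"
  shows "group (Aut G)"
proof -
  interpret A: group "AutoGroup G" using assms by (rule group.AutoGroup)
  show ?thesis
    by (rule groupI) (auto simp: Aut_def A.m_assoc intro: A.r_inv A.inv_closed)
qed

lemma \<epsilon>_gen:
  assumes "i \<in> {1..n}" "j \<in> {1..n}" "l \<in> {1..n}"
  shows "\<epsilon> n i j (gen l) =
    (if l = i then inv\<^bsub>F n\<^esub> gen j \<otimes>\<^bsub>F n\<^esub> gen i \<otimes>\<^bsub>F n\<^esub> gen j else gen l)"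
proof -
  interpret group "F n" by (rule group_free_group)
  show ?thesis
    unfolding \<epsilon>_def using assms by (subst free_lift_gen) (auto simp: gen_closed is_group simp del: One_nat_def)
qed

lemma \<epsilon>_in_Aut:
  assumes i: "i \<in> {1..n}" and j: "j \<in> {1..n}" and ij: "i \<noteq> j"
  shows "\<epsilon> n i j \<in> carrier (Aut (F n))"
proof -
  interpret group "F n" by (rule group_free_group)
  note One_nat_def [simp del]
  define e' where "e' = free_lift {1..n} (F n)
    (\<lambda>l. if l = i then gen j \<otimes>\<^bsub>F n\<^esub> gen i \<otimes>\<^bsub>F n\<^esub> inv\<^bsub>F n\<^esub> gen j else gen l)"
  let ?e = "\<epsilon> n i j"
  have gc: "gen l \<in> carrier (F n)" if "l \<in> {1..n}" for l
    using that by (rule gen_closed)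
  have eh: "?e \<in> hom (F n) (F n)"
    unfolding \<epsilon>_def using i j by (intro free_lift_hom is_group) (auto simp: gen_closed is_group)
  have e'h: "e' \<in> hom (F n) (F n)"
    unfolding e'_def using i j by (intro free_lift_hom is_group) (auto simp: gen_closed is_group)
  interpret e: group_hom "F n" "F n" "?e"
    using eh by (simp add: group_hom_def group_hom_axioms_def is_group)
  interpret e': group_hom "F n" "F n" e'
    using e'h by (simp add: group_hom_def group_hom_axioms_def is_group)
  have e'_gen: "e' (gen l) =
      (if l = i then gen j \<otimes>\<^bsub>F n\<^esub> gen i \<otimes>\<^bsub>F n\<^esub> inv\<^bsub>F n\<^esub> gen j else gen l)"
    if "l \<in> {1..n}" for l
    unfolding e'_def using that i j by (subst free_lift_gen) (auto simp: gen_closed is_group)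
  have idh: "(\<lambda>w. w) \<in> hom (F n) (F n)" by (simp add: hom_def)
  have cancel: "a \<otimes>\<^bsub>F n\<^esub> (inv\<^bsub>F n\<^esub> a \<otimes>\<^bsub>F n\<^esub> b) = b" "inv\<^bsub>F n\<^esub> a \<otimes>\<^bsub>F n\<^esub> (a \<otimes>\<^bsub>F n\<^esub> b) = b"
    if "a \<in> carrier (F n)" "b \<in> carrier (F n)" for a b
    using that by (simp_all add: m_assoc[symmetric])
  have 1: "e' (?e w) = w" if "w \<in> carrier (F n)" for w
  proof -
    have "(e' \<circ> ?e) w = (\<lambda>w. w) w"
    proof (rule free_group_hom_eqI[OF is_group Group.hom_compose[OF eh e'h] idh _ that])
      fix l assume "l \<in> {1..n}"
      then show "(e' \<circ> ?e) (gen l) = gen l"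
        using i j ij by (simp add: \<epsilon>_gen e'_gen gc m_assoc cancel)
    qed
    then show ?thesis by simp
  qed
  have 2: "?e (e' w) = w" if "w \<in> carrier (F n)" for w
  proof -
    have "(?e \<circ> e') w = (\<lambda>w. w) w"
    proof (rule free_group_hom_eqI[OF is_group Group.hom_compose[OF e'h eh] idh _ that])
      fix l assume "l \<in> {1..n}"
      then show "(?e \<circ> e') (gen l) = gen l"
        using i j ij by (simp add: \<epsilon>_gen e'_gen gc m_assoc cancel)
    qed
    then show ?thesis by simp
  qed
  have "bij_betw ?e (carrier (F n)) (carrier (F n))"
    by (rule bij_betw_byWitness[where f' = e']) (auto simp: 1 2)
  then show ?thesis
    using eh by (simp add: carrier_Aut auto_def Bij_def \<epsilon>_def free_lift_def)
qed

end

theory Submission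
  imports Defs
begin

text \<open>
  There are two independent halves: the automorphisms \<open>\<epsilon>\<^sub>i\<^sub>j\<close> together with the permutation
  automorphisms generate \<open>C\<^sub>n\<close>, and the group generated by the \<open>\<epsilon>\<^sub>i\<^sub>j\<close> is
  \<open>D\<^sub>1 D\<^sub>2 \<dots> D\<^sub>n\<^sub>-\<^sub>1\<close>.

  The first half is a descent on the total length of the conjugating words \<open>f\<^sub>i\<close>, where
  \<open>\<phi> x\<^sub>i = f\<^sub>i\<^sup>-\<^sup>1 x\<^sub>\<pi>\<^sub>i f\<^sub>i\<close>. If \<open>f\<^sub>i\<close> begins with a power of \<open>x\<^sub>\<pi>\<^sub>i\<close>, that letter can be
  dropped. If \<open>f\<^sub>j\<close> ends in \<open>x\<^sub>\<pi>\<^sub>i\<^sup>\<plusminus>\<^sup>1 f\<^sub>i\<close> for some \<open>i \<noteq> j\<close>, then multiplying \<open>\<phi>\<close> from the left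
  by \<open>\<epsilon>\<^sub>j\<^sub>i\<^sup>\<plusminus>\<^sup>1\<close> conjugates the image of \<open>x\<^sub>j\<close> by that of \<open>x\<^sub>i\<close> and deletes this letter
  (\<open>conjugating_reduce_peak\<close>). If neither happens, then in a product of images
  \<open>\<phi> x\<^sub>i\<^sup>\<plusminus>\<^sup>1\<close> along a reduced word, cancellation never reaches a middle letter
  (\<open>middle_letter_survives\<close>). Since \<open>\<phi>\<close> is onto, each generator \<open>x\<^sub>\<pi>\<^sub>i\<close> is such a product, and
  this forces \<open>f\<^sub>i = 1\<close>, so \<open>\<phi>\<close> is a permutation automorphism.

  The second half peels off the factors from the right. The generators \<open>\<epsilon>\<^sub>i\<^sub>j\<close> with
  \<open>i, j \<le> m + 1\<close> are those with \<open>i, j \<le> m\<close> and those of \<open>D\<^sub>m\<close>; McCool's relations show that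
  the former normalise \<open>D\<^sub>m\<close> (\<open>\<epsilon>_normalises_D\<close>). Hence the group generated by both is the
  product of the group for \<open>m\<close> and \<open>D\<^sub>m\<close>, and induction on \<open>m\<close> finishes the proof.
\<close>

(* The simplifier would turn F n into free_group {Suc 0..n}, and then rules about F n no longer
   match. *)
declare One_nat_def [simp del]

section \<open>Reduced words\<close>

lemma free_group_mult: "u \<otimes>\<^bsub>free_group X\<^esub> v = foldr push u v"
  by (simp add: free_group_def)

lemma free_group_one: "\<one>\<^bsub>free_group X\<^esub> = []"
  by (simp add: free_group_def)

lemma free_group_carrier:
  "w \<in> carrier (free_group X) \<longleftrightarrow> fst ` set w \<subseteq> X \<and> reduced w"
  by (simp add: free_group_def)

lemma reduced_append_iff:
  "reduced (u @ v) \<longleftrightarrow>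
    reduced u \<and> reduced v \<and> (u = [] \<or> v = [] \<or> hd v \<noteq> flip (last u))"
  by (simp add: reduced_def successively_append_iff)

lemma free_group_append_closed_iff:
  "u @ v \<in> carrier (free_group X) \<longleftrightarrow>
    u \<in> carrier (free_group X) \<and> v \<in> carrier (free_group X) \<and>
    (u = [] \<or> v = [] \<or> hd v \<noteq> flip (last u))"
  by (auto simp: free_group_carrier reduced_append_iff)

lemma free_group_mult_eq_append:
  "reduced (u @ v) \<Longrightarrow> u \<otimes>\<^bsub>free_group X\<^esub> v = u @ v"
  unfolding free_group_mult
  by (induction u) (auto simp: push_reduced reduced_Cons)

lemma reduced_rev_flip: "reduced u \<Longrightarrow> reduced (rev (map flip u))"
proof -
  have "q \<noteq> flip p \<Longrightarrow> flip p \<noteq> q" for p q :: "'a letter" by auto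
  moreover have "flip q = p \<longleftrightarrow> q = flip p" for p q :: "'a letter" by auto
  moreover assume "reduced u"
  ultimately show ?thesis
    unfolding reduced_def successively_rev successively_map
    by (auto elim!: successively_mono)
qed

lemma free_group_inv:
  assumes "u \<in> carrier (free_group X)"
  shows "inv\<^bsub>free_group X\<^esub> u = rev (map flip u)"
proof (rule group.inv_equality[OF group_free_group _ assms])
  have "reduced u" using assms by (simp add: free_group_carrier)
  then show "rev (map flip u) \<otimes>\<^bsub>free_group X\<^esub> u = \<one>\<^bsub>free_group X\<^esub>"
    using foldr_push_inverse[of "[]" u]
    by (simp add: free_group_mult free_group_one foldr_push_Nil)
  show "rev (map flip u) \<in> carrier (free_group X)"
    using assms by (auto simp: free_group_carrier reduced_rev_flip)
qed

lemma letter_closed: "fst p \<in> X \<Longrightarrow> [p] \<in> carrier (free_group X)"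
  by (simp add: free_group_carrier reduced_Cons)

lemma inv_letter: "fst p \<in> X \<Longrightarrow> inv\<^bsub>free_group X\<^esub> [p] = [flip p]"
  by (simp add: free_group_inv letter_closed)

lemma length_push_le: "length (push p w) \<le> Suc (length w)"
  by (cases w) auto

lemma length_mult_le: "length (u \<otimes>\<^bsub>free_group X\<^esub> v) \<le> length u + length v"
  unfolding free_group_mult
proof (induction u)
  case (Cons p u)
  then show ?case using length_push_le[of p "foldr push u v"] by simp
qed simp

section \<open>Automorphisms\<close>

lemma (in group) inv_cancel:
  assumes "a \<in> carrier G" "b \<in> carrier G"
  shows "a \<otimes> (inv a \<otimes> b) = b" "inv a \<otimes> (a \<otimes> b) = b"
  using assms by (simp_all add: m_assoc[symmetric])

lemma Aut_group_hom:
  assumes "group G" "\<phi> \<in> carrier (Aut G)"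
  shows "group_hom G G \<phi>"
  using assms by (simp add: carrier_Aut auto_def group_hom_def group_hom_axioms_def)

lemma Aut_mult_apply:
  assumes "\<phi> \<in> carrier (Aut G)" "\<psi> \<in> carrier (Aut G)" "x \<in> carrier G"
  shows "(\<phi> \<otimes>\<^bsub>Aut G\<^esub> \<psi>) x = \<psi> (\<phi> x)"
  using assms by (simp add: mult_Aut)

lemma Aut_one_apply: "x \<in> carrier G \<Longrightarrow> \<one>\<^bsub>Aut G\<^esub> x = x"
  by (simp add: Aut_def AutoGroup_def BijGroup_def)

lemma Aut_surj:
  assumes "\<phi> \<in> carrier (Aut G)" "y \<in> carrier G"
  obtains x where "x \<in> carrier G" "\<phi> x = y"
proof -
  have "\<phi> ` carrier G = carrier G"
    using assms(1) by (simp add: carrier_Aut auto_def Bij_def bij_betw_def)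
  then have "y \<in> \<phi> ` carrier G" using assms(2) by simp
  then show thesis using that by (metis imageE)
qed

lemma Aut_free_group_eqI:
  assumes \<phi>: "\<phi> \<in> carrier (Aut (free_group X))" and \<psi>: "\<psi> \<in> carrier (Aut (free_group X))"
    and eq: "\<And>x. x \<in> X \<Longrightarrow> \<phi> (gen x) = \<psi> (gen x)"
  shows "\<phi> = \<psi>"
proof (rule extensionalityI)
  show "\<phi> \<in> extensional (carrier (free_group X))" "\<psi> \<in> extensional (carrier (free_group X))"
    using \<phi> \<psi> by (auto simp: carrier_Aut auto_def Bij_def)
  have "\<phi> \<in> hom (free_group X) (free_group X)" "\<psi> \<in> hom (free_group X) (free_group X)"
    using \<phi> \<psi> by (simp_all add: carrier_Aut auto_def)
  then show "\<phi> w = \<psi> w" if "w \<in> carrier (free_group X)" for w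
    by (rule free_group_hom_eqI[OF group_free_group, where h = \<phi> and k = \<psi>]) (rule eq that, assumption?)+
qed

lemma inv_\<epsilon>_gen:
  assumes i: "i \<in> {1..n}" and j: "j \<in> {1..n}" and ij: "i \<noteq> j" and l: "l \<in> {1..n}"
  shows "(inv\<^bsub>Aut (F n)\<^esub> \<epsilon> n i j) (gen l) =
    (if l = i then gen j \<otimes>\<^bsub>F n\<^esub> gen i \<otimes>\<^bsub>F n\<^esub> inv\<^bsub>F n\<^esub> gen j else gen l)"
proof -
  interpret group "F n" by (rule group_free_group)
  interpret A: group "Aut (F n)" by (rule group_Aut[OF is_group])
  let ?e = "\<epsilon> n i j" and ?e' = "inv\<^bsub>Aut (F n)\<^esub> \<epsilon> n i j"
  have e: "?e \<in> carrier (Aut (F n))" by (rule \<epsilon>_in_Aut[OF i j ij])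
  interpret e': group_hom "F n" "F n" ?e'
    by (rule Aut_group_hom[OF is_group A.inv_closed[OF e]])
  have undo: "?e' (?e w) = w" if "w \<in> carrier (F n)" for w
  proof -
    have "?e' (?e w) = (?e \<otimes>\<^bsub>Aut (F n)\<^esub> ?e') w"
      by (rule Aut_mult_apply[OF e A.inv_closed[OF e] that, symmetric])
    also have "\<dots> = w"
      unfolding A.r_inv[OF e] by (rule Aut_one_apply[OF that])
    finally show ?thesis .
  qed
  have fixed: "?e' (gen k) = gen k" if "k \<in> {1..n}" "k \<noteq> i" for k
    using undo[OF gen_closed[OF that(1)]] that(2) by (simp add: \<epsilon>_gen[OF i j that(1)])
  note gc = gen_closed[OF i] gen_closed[OF j]
  have "?e' (inv\<^bsub>F n\<^esub> gen j \<otimes>\<^bsub>F n\<^esub> gen i \<otimes>\<^bsub>F n\<^esub> gen j) = gen i"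
    using undo[OF gc(1)] \<epsilon>_gen[OF i j i] by simp
  moreover have "?e' (inv\<^bsub>F n\<^esub> gen j \<otimes>\<^bsub>F n\<^esub> gen i \<otimes>\<^bsub>F n\<^esub> gen j) =
      inv\<^bsub>F n\<^esub> gen j \<otimes>\<^bsub>F n\<^esub> ?e' (gen i) \<otimes>\<^bsub>F n\<^esub> gen j"
    using gc fixed[OF j ij[symmetric]] by simp
  ultimately have conj: "inv\<^bsub>F n\<^esub> gen j \<otimes>\<^bsub>F n\<^esub> ?e' (gen i) \<otimes>\<^bsub>F n\<^esub> gen j = gen i"
    by (simp only:)
  have "gen j \<otimes>\<^bsub>F n\<^esub> (inv\<^bsub>F n\<^esub> gen j \<otimes>\<^bsub>F n\<^esub> ?e' (gen i) \<otimes>\<^bsub>F n\<^esub> gen j) \<otimes>\<^bsub>F n\<^esub>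
      inv\<^bsub>F n\<^esub> gen j = ?e' (gen i)"
    using gc e'.hom_closed[OF gc(1)] by (simp add: m_assoc inv_cancel)
  then have "?e' (gen i) = gen j \<otimes>\<^bsub>F n\<^esub> gen i \<otimes>\<^bsub>F n\<^esub> inv\<^bsub>F n\<^esub> gen j"
    unfolding conj by (rule sym)
  then show ?thesis using fixed[OF l] by metis
qed

section \<open>Reduction of conjugating words\<close>

text \<open>
  Membership in \<^const>\<open>C\<close> with its witnesses made visible. An automorphism has many families
  \<open>f\<close>, because \<open>f i\<close> is only determined up to powers of \<open>gen (\<pi> i)\<close> on its left; the descent
  below changes \<open>f\<close> while \<open>\<phi>\<close> may stay the same.
\<close>

definition conjugating ::
  "nat \<Rightarrow> (nat \<Rightarrow> nat) \<Rightarrow> (nat \<Rightarrow> nat letter list) \<Rightarrow> (nat letter list \<Rightarrow> nat letter list) \<Rightarrow> bool"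
where
  "conjugating n \<pi> f \<phi> \<longleftrightarrow> \<phi> \<in> carrier (Aut (F n)) \<and> \<pi> permutes {1..n} \<and>
    (\<forall>i\<in>{1..n}. f i \<in> carrier (F n) \<and>
      \<phi> (gen i) = inv\<^bsub>F n\<^esub> f i \<otimes>\<^bsub>F n\<^esub> gen (\<pi> i) \<otimes>\<^bsub>F n\<^esub> f i)"

lemma conjugatingD:
  assumes "conjugating n \<pi> f \<phi>"
  shows "\<phi> \<in> carrier (Aut (F n))" and "\<pi> permutes {1..n}"
    and "i \<in> {1..n} \<Longrightarrow> f i \<in> carrier (F n)"
    and "i \<in> {1..n} \<Longrightarrow> \<pi> i \<in> {1..n}"
    and "i \<in> {1..n} \<Longrightarrow> \<phi> (gen i) = inv\<^bsub>F n\<^esub> f i \<otimes>\<^bsub>F n\<^esub> gen (\<pi> i) \<otimes>\<^bsub>F n\<^esub> f i"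
  using assms unfolding conjugating_def by (blast, blast, blast, metis permutes_in_image, blast)

lemma conjugating_update:
  assumes conj: "conjugating n \<pi> f \<phi>" and \<psi>: "\<psi> \<in> carrier (Aut (F n))" and g: "g \<in> carrier (F n)"
    and j: "\<psi> (gen j) = inv\<^bsub>F n\<^esub> g \<otimes>\<^bsub>F n\<^esub> gen (\<pi> j) \<otimes>\<^bsub>F n\<^esub> g"
    and other: "\<And>l. \<lbrakk>l \<in> {1..n}; l \<noteq> j\<rbrakk> \<Longrightarrow> \<psi> (gen l) = \<phi> (gen l)"
  shows "conjugating n \<pi> (f(j := g)) \<psi>"
  unfolding conjugating_def
proof (intro conjI ballI \<psi> conjugatingD(2)[OF conj])
  fix l assume l: "l \<in> {1..n}"
  show "(f(j := g)) l \<in> carrier (F n)"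
    using g conjugatingD(3)[OF conj l] by simp
  show "\<psi> (gen l) = inv\<^bsub>F n\<^esub> (f(j := g)) l \<otimes>\<^bsub>F n\<^esub> gen (\<pi> l) \<otimes>\<^bsub>F n\<^esub> (f(j := g)) l"
    using j other[OF l] conjugatingD(5)[OF conj l] by simp
qed

lemma conjugating_letter:
  assumes conj: "conjugating n \<pi> f \<phi>" and i: "i \<in> {1..n}"
  shows "\<phi> [(i, a)] = inv\<^bsub>F n\<^esub> f i \<otimes>\<^bsub>F n\<^esub> [(\<pi> i, a)] \<otimes>\<^bsub>F n\<^esub> f i"
proof -
  interpret group "F n" by (rule group_free_group)
  interpret \<phi>: group_hom "F n" "F n" \<phi>
    by (rule Aut_group_hom[OF is_group conjugatingD(1)[OF conj]])
  note \<pi>i = conjugatingD(4)[OF conj i] and f = conjugatingD(3)[OF conj i]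
  have eq: "\<phi> [(i, True)] = inv\<^bsub>F n\<^esub> f i \<otimes>\<^bsub>F n\<^esub> [(\<pi> i, True)] \<otimes>\<^bsub>F n\<^esub> f i"
    using conjugatingD(5)[OF conj i] by (simp add: gen_def)
  have cl: "[(i, True)] \<in> carrier (F n)" "[(\<pi> i, True)] \<in> carrier (F n)"
    using i \<pi>i by (auto intro!: letter_closed)
  show ?thesis
  proof (cases a)
    case True
    then show ?thesis using eq by simp
  next
    case False
    have "[(i, a)] = inv\<^bsub>F n\<^esub> [(i, True)]" "[(\<pi> i, a)] = inv\<^bsub>F n\<^esub> [(\<pi> i, True)]"
      using i \<pi>i False by (simp_all add: inv_letter flip_def)
    then show ?thesis using eq cl f by (simp add: inv_mult_group m_assoc)
  qed
qed

lemma conjugating_letter_word: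
  assumes conj: "conjugating n \<pi> f \<phi>" and i: "i \<in> {1..n}"
    and tight: "\<And>a u. f i \<noteq> (\<pi> i, a) # u"
  shows "\<phi> [(i, a)] = rev (map flip (f i)) @ (\<pi> i, a) # f i"
proof -
  interpret group "F n" by (rule group_free_group)
  note \<pi>i = conjugatingD(4)[OF conj i] and f = conjugatingD(3)[OF conj i]
  have red: "reduced (f i)" using f by (simp add: free_group_carrier)
  have hd: "fst (hd (f i)) \<noteq> \<pi> i" if "f i \<noteq> []"
    using that tight by (metis list.collapse prod.collapse)
  have 1: "reduced ([(\<pi> i, a)] @ f i)"
    using red hd by (auto simp: reduced_append_iff reduced_Cons)
  have 2: "reduced (rev (map flip (f i)) @ ([(\<pi> i, a)] @ f i))"
  proof (cases "f i = []")
    case False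
    have "(\<pi> i, a) \<noteq> hd (f i)" using hd[OF False] by (metis fst_conv)
    then show ?thesis
      using 1 reduced_rev_flip[OF red] False
      by (subst reduced_append_iff) (simp add: last_rev hd_map)
  qed (use 1 in simp)
  have "\<phi> [(i, a)] = inv\<^bsub>F n\<^esub> f i \<otimes>\<^bsub>F n\<^esub> ([(\<pi> i, a)] \<otimes>\<^bsub>F n\<^esub> f i)"
    using conjugating_letter[OF conj i, of a] f \<pi>i by (simp add: m_assoc letter_closed)
  also have "\<dots> = rev (map flip (f i)) @ ([(\<pi> i, a)] @ f i)"
    by (simp only: free_group_inv[OF f] free_group_mult_eq_append[OF 1] free_group_mult_eq_append[OF 2])
  finally show ?thesis by simp
qed

text \<open>
  Write \<open>f i = u @ s\<close> and \<open>f j = v @ s\<close> with the longest common suffix \<open>s\<close>. In the product of the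
  images of two consecutive letters, built on \<open>i\<close> and \<open>j\<close>, exactly \<open>s\<close> cancels against its
  inverse. What is left meets at the last letter of \<open>u\<close> (or the middle letter of the first factor
  if \<open>u\<close> is empty) and the inverse of the last letter of \<open>v\<close> (or the middle letter of the
  second factor if \<open>v\<close> is empty). If both of \<open>u\<close>, \<open>v\<close> are nonempty, these do not cancel because
  \<open>s\<close> is longest; if exactly one is empty, because there is no peak; if both are empty,
  because \<open>\<pi>\<close> is injective and the given word is reduced.
\<close>
lemma middle_letter_survives:
  assumes conj: "conjugating n \<pi> f \<phi>"
    and tight: "\<And>i a u. i \<in> {1..n} \<Longrightarrow> f i \<noteq> (\<pi> i, a) # u"
    and no_peak: "\<And>i j a v. \<lbrakk>i \<in> {1..n}; j \<in> {1..n}; i \<noteq> j\<rbrakk> \<Longrightarrow> f j \<noteq> v @ (\<pi> i, a) # f i"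
    and w: "(i, a) # w \<in> carrier (F n)"
  shows "\<exists>z. \<phi> ((i, a) # w) = rev (map flip (f i)) @ (\<pi> i, a) # z"
  using w
proof (induction w arbitrary: i a)
  case Nil
  then have "i \<in> {1..n}" by (simp add: free_group_carrier)
  then show ?case using conjugating_letter_word[OF conj _ tight] by blast
next
  case (Cons p w)
  interpret group "F n" by (rule group_free_group)
  interpret \<phi>: group_hom "F n" "F n" \<phi>
    by (rule Aut_group_hom[OF is_group conjugatingD(1)[OF conj]])
  obtain j b where p: "p = (j, b)" by (cases p)
  have i: "i \<in> {1..n}" and j: "j \<in> {1..n}"
    and ab: "(j, b) \<noteq> flip (i, a)" and jw: "(j, b) # w \<in> carrier (F n)"
    and red: "reduced ([(i, a)] @ (j, b) # w)"
    using Cons.prems by (auto simp: p free_group_carrier reduced_Cons)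
  have inj: "\<pi> i = \<pi> j \<longleftrightarrow> i = j"
    using permutes_inj[OF conjugatingD(2)[OF conj]] by (auto dest: injD)
  obtain z where z: "\<phi> ((j, b) # w) = rev (map flip (f j)) @ (\<pi> j, b) # z"
    using Cons.IH[OF jw] by blast
  have i0: "[(i, a)] \<in> carrier (F n)" using i by (simp add: letter_closed)
  obtain s u v where fi: "f i = u @ s" and fj: "f j = v @ s"
    and max: "u = [] \<or> v = [] \<or> last u \<noteq> last v"
    using longest_common_suffix by blast
  define X where "X = rev (map flip (f i)) @ (\<pi> i, a) # u"
  define Y where "Y = rev (map flip v) @ (\<pi> j, b) # z"
  have Xs: "\<phi> [(i, a)] = X @ s"
    using conjugating_letter_word[OF conj i tight[OF i]] by (simp add: X_def fi)
  have sY: "\<phi> ((j, b) # w) = rev (map flip s) @ Y"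
    using z by (simp add: Y_def fj)
  have "X @ s \<in> carrier (F n)" "rev (map flip s) @ Y \<in> carrier (F n)"
    using \<phi>.hom_closed[OF i0] \<phi>.hom_closed[OF jw] by (simp_all only: Xs sY)
  moreover from this have "s \<in> carrier (F n)"
    by (simp add: free_group_append_closed_iff)
  ultimately have Xc: "X \<in> carrier (F n)" and sc: "s \<in> carrier (F n)" and Yc: "Y \<in> carrier (F n)"
    and Xs': "X @ s = X \<otimes>\<^bsub>F n\<^esub> s"
    and sY': "rev (map flip s) @ Y = inv\<^bsub>F n\<^esub> s \<otimes>\<^bsub>F n\<^esub> Y"
    by (simp_all add: free_group_append_closed_iff free_group_inv)
      (simp_all add: free_group_mult_eq_append free_group_carrier reduced_append_iff)
  have lastX: "last X = (if u = [] then (\<pi> i, a) else last u)" by (simp add: X_def)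
  have hdY: "hd Y = (if v = [] then (\<pi> j, b) else flip (last v))"
    by (simp add: Y_def hd_rev last_map)
  have "hd Y \<noteq> flip (last X)"
  proof (cases "i = j")
    case True
    then have "u = []" "v = []" using fi fj max by auto
    then show ?thesis using ab True by (simp add: lastX hdY flip_def)
  next
    case False
    have 1: "last v \<noteq> (\<pi> i, a)" if "u = []" "v \<noteq> []"
      using no_peak[OF i j False, of "butlast v" a] that fi fj append_butlast_last_id[of v]
      by (metis append.assoc append_Cons append_Nil)
    have 2: "last u \<noteq> flip (\<pi> j, b)" if "v = []" "u \<noteq> []"
      using no_peak[OF j i, of "butlast u" "\<not> b"] False that fi fj append_butlast_last_id[of u]
      by (metis append.assoc append_Cons append_Nil flip_def fst_conv snd_conv)
    show ?thesis
      using 1 2 max inj False by (auto simp: lastX hdY flip_def prod_eq_iff)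
  qed
  then have XY: "reduced (X @ Y)"
    using Xc Yc by (simp add: reduced_append_iff free_group_carrier)
  have "\<phi> ((i, a) # p # w) = \<phi> ([(i, a)] \<otimes>\<^bsub>F n\<^esub> ((j, b) # w))"
    using free_group_mult_eq_append[OF red] by (simp add: p)
  also have "\<dots> = (X \<otimes>\<^bsub>F n\<^esub> s) \<otimes>\<^bsub>F n\<^esub> (inv\<^bsub>F n\<^esub> s \<otimes>\<^bsub>F n\<^esub> Y)"
    using i0 jw by (simp only: \<phi>.hom_mult Xs sY Xs' sY')
  also have "\<dots> = X \<otimes>\<^bsub>F n\<^esub> Y"
    using Xc Yc sc by (simp add: m_assoc inv_cancel)
  also have "\<dots> = X @ Y" by (rule free_group_mult_eq_append[OF XY])
  finally show ?case by (simp add: X_def)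
qed

text \<open>
  Surjectivity enters here. If \<open>\<phi> w\<close> is the single letter \<open>\<pi> i\<close>, the surviving middle letter of the
  first factor must be that letter, so \<open>w\<close> starts with \<open>i\<close> and nothing precedes the middle letter,
  which says that \<open>f i\<close> is empty.
\<close>
lemma peak_free_imp_perm_auto:
  assumes conj: "conjugating n \<pi> f \<phi>"
    and tight: "\<And>i a u. i \<in> {1..n} \<Longrightarrow> f i \<noteq> (\<pi> i, a) # u"
    and no_peak: "\<And>i j a v. \<lbrakk>i \<in> {1..n}; j \<in> {1..n}; i \<noteq> j\<rbrakk> \<Longrightarrow> f j \<noteq> v @ (\<pi> i, a) # f i"
  shows "\<phi> \<in> perm_autos n"
proof -
  interpret group "F n" by (rule group_free_group)
  interpret \<phi>: group_hom "F n" "F n" \<phi>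
    by (rule Aut_group_hom[OF is_group conjugatingD(1)[OF conj]])
  have empty: "f i = []" if i: "i \<in> {1..n}" for i
  proof -
    note \<pi>i = conjugatingD(4)[OF conj i]
    obtain w where w: "w \<in> carrier (F n)" and \<phi>w: "\<phi> w = gen (\<pi> i)"
      by (rule Aut_surj[OF conjugatingD(1)[OF conj] gen_closed[OF \<pi>i]])
    have "w \<noteq> []" using \<phi>w \<phi>.hom_one by (auto simp: free_group_one gen_def)
    then obtain j b w' where w': "w = (j, b) # w'" by (cases w) auto
    then obtain z where z: "\<phi> w = rev (map flip (f j)) @ (\<pi> j, b) # z"
      using middle_letter_survives[OF conj tight no_peak, of j b w'] w by blast
    have "f j = []"
      using arg_cong[OF z, of length] \<phi>w by (simp add: gen_def)
    moreover from this have "\<pi> j = \<pi> i" using z \<phi>w by (simp add: gen_def)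
    then have "j = i"
      using permutes_inj[OF conjugatingD(2)[OF conj]] by (simp add: inj_eq)
    ultimately show ?thesis by simp
  qed
  have "\<phi> (gen i) = gen (\<pi> i)" if "i \<in> {1..n}" for i
  proof -
    have "f i = \<one>\<^bsub>F n\<^esub>" using empty[OF that] by (simp only: free_group_one)
    with gen_closed[OF conjugatingD(4)[OF conj that]] show ?thesis
      unfolding conjugatingD(5)[OF conj that] by simp
  qed
  then show ?thesis
    unfolding perm_autos_def using conjugatingD(1,2)[OF conj]
    by (intro CollectI conjI exI[of _ \<pi>] ballI)
qed

text \<open>
  A letter on \<open>\<pi> i\<close> commutes with \<open>gen (\<pi> i)\<close>, so it may be dropped from the front of \<open>f i\<close>.
\<close>
lemma conjugating_cancel_first:
  assumes conj: "conjugating n \<pi> f \<phi>" and i: "i \<in> {1..n}" and fi: "f i = (\<pi> i, a) # u"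
  shows "conjugating n \<pi> (f(i := u)) \<phi>"
proof -
  interpret group "F n" by (rule group_free_group)
  note \<pi>i = conjugatingD(4)[OF conj i]
  let ?x = "[(\<pi> i, a)]"
  have u: "u \<in> carrier (F n)" and fi': "f i = ?x \<otimes>\<^bsub>F n\<^esub> u"
    using conjugatingD(3)[OF conj i] fi
    by (auto simp: free_group_carrier reduced_Cons free_group_mult push_reduced)
  have x: "?x \<in> carrier (F n)" and g: "gen (\<pi> i) \<in> carrier (F n)"
    using \<pi>i by (simp_all add: letter_closed gen_closed)
  have "?x = gen (\<pi> i) \<or> ?x = inv\<^bsub>F n\<^esub> gen (\<pi> i)"
    using inv_gen[OF \<pi>i] by (cases a) (auto simp: gen_def)
  then have "inv\<^bsub>F n\<^esub> ?x \<otimes>\<^bsub>F n\<^esub> gen (\<pi> i) \<otimes>\<^bsub>F n\<^esub> ?x = gen (\<pi> i)"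
    using g by (auto simp: m_assoc)
  moreover have "\<phi> (gen i) =
      inv\<^bsub>F n\<^esub> u \<otimes>\<^bsub>F n\<^esub> (inv\<^bsub>F n\<^esub> ?x \<otimes>\<^bsub>F n\<^esub> gen (\<pi> i) \<otimes>\<^bsub>F n\<^esub> ?x) \<otimes>\<^bsub>F n\<^esub> u"
    using conjugatingD(5)[OF conj i] u x g by (simp add: fi' inv_mult_group m_assoc)
  ultimately show ?thesis
    using u by (intro conjugating_update[OF conj conjugatingD(1)[OF conj]]) simp_all
qed

text \<open>
  The letter between \<open>v\<close> and \<open>f i\<close> cancels: multiplying \<open>\<phi>\<close> from the left by \<open>e\<close> replaces
  \<open>\<phi> (gen j)\<close> by its conjugate with \<open>\<phi> [(i, a)] = (f i)\<^sup>-\<^sup>1 (\<pi> i, a) (f i)\<close>, which changes \<open>f j\<close> into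
  \<open>v (\<pi> i, a) (f i) \<cdot> (f i)\<^sup>-\<^sup>1 (\<pi> i, a)\<^sup>-\<^sup>1 (f i) = v (f i)\<close>. The new word is a product in the free group
  and not a concatenation, since \<open>v\<close> and \<open>f i\<close> may cancel further; this only helps.
\<close>
lemma conjugating_reduce_peak:
  assumes conj: "conjugating n \<pi> f \<phi>"
    and i: "i \<in> {1..n}" and j: "j \<in> {1..n}" and ij: "i \<noteq> j"
    and fj: "f j = v @ (\<pi> i, a) # f i"
  defines "e \<equiv> if a then inv\<^bsub>Aut (F n)\<^esub> \<epsilon> n j i else \<epsilon> n j i"
  shows "conjugating n \<pi> (f(j := v \<otimes>\<^bsub>F n\<^esub> f i)) (e \<otimes>\<^bsub>Aut (F n)\<^esub> \<phi>)"
proof -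
  interpret group "F n" by (rule group_free_group)
  interpret A: group "Aut (F n)" by (rule group_Aut[OF is_group])
  interpret \<phi>: group_hom "F n" "F n" \<phi>
    by (rule Aut_group_hom[OF is_group conjugatingD(1)[OF conj]])
  have e: "e \<in> carrier (Aut (F n))"
    unfolding e_def using \<epsilon>_in_Aut[OF j i] ij by simp
  have e\<phi>: "(e \<otimes>\<^bsub>Aut (F n)\<^esub> \<phi>) (gen l) = \<phi> (e (gen l))" if "l \<in> {1..n}" for l
    using that e conjugatingD(1)[OF conj] by (simp add: Aut_mult_apply gen_closed)
  let ?y = "[(i, a)]" and ?x = "[(\<pi> i, a)]"
  have y: "?y \<in> carrier (F n)" using i by (simp add: letter_closed)
  have x: "?x \<in> carrier (F n)" using conjugatingD(4)[OF conj i] by (simp add: letter_closed)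
  have fi: "f i \<in> carrier (F n)" by (rule conjugatingD(3)[OF conj i])
  have xi: "?x @ f i = ?x \<otimes>\<^bsub>F n\<^esub> f i" and v: "v \<in> carrier (F n)"
    and vxi: "f j = v \<otimes>\<^bsub>F n\<^esub> (?x @ f i)"
    using conjugatingD(3)[OF conj j] unfolding fj
    by (auto simp: free_group_append_closed_iff free_group_mult_eq_append
        free_group_carrier reduced_append_iff)
  have fj': "f j = v \<otimes>\<^bsub>F n\<^esub> (?x \<otimes>\<^bsub>F n\<^esub> f i)" using vxi xi by simp
  have gj: "gen j \<in> carrier (F n)" "gen (\<pi> j) \<in> carrier (F n)"
    using j conjugatingD(4)[OF conj j] by (simp_all add: gen_closed)
  have other: "e (gen l) = gen l" if "l \<in> {1..n}" "l \<noteq> j" for l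
    using that i j ij by (auto simp: e_def inv_\<epsilon>_gen \<epsilon>_gen)
  have "e (gen j) = ?y \<otimes>\<^bsub>F n\<^esub> gen j \<otimes>\<^bsub>F n\<^esub> inv\<^bsub>F n\<^esub> ?y"
  proof (cases a)
    case True
    then have "?y = gen i" by (simp add: gen_def)
    then show ?thesis using True inv_\<epsilon>_gen[OF j i _ j] ij by (simp add: e_def)
  next
    case False
    then have "?y = inv\<^bsub>F n\<^esub> gen i" using inv_gen[OF i] by simp
    then show ?thesis using False \<epsilon>_gen[OF j i j] gen_closed[OF i] by (simp add: e_def)
  qed
  then have "(e \<otimes>\<^bsub>Aut (F n)\<^esub> \<phi>) (gen j) = \<phi> ?y \<otimes>\<^bsub>F n\<^esub> \<phi> (gen j) \<otimes>\<^bsub>F n\<^esub> inv\<^bsub>F n\<^esub> \<phi> ?y"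
    using e\<phi>[OF j] y gj by simp
  also have "\<dots> = inv\<^bsub>F n\<^esub> (v \<otimes>\<^bsub>F n\<^esub> f i) \<otimes>\<^bsub>F n\<^esub> gen (\<pi> j) \<otimes>\<^bsub>F n\<^esub> (v \<otimes>\<^bsub>F n\<^esub> f i)"
    unfolding conjugating_letter[OF conj i] conjugatingD(5)[OF conj j] fj'
    using v x fi gj by (simp add: inv_mult_group m_assoc inv_cancel)
  finally have "(e \<otimes>\<^bsub>Aut (F n)\<^esub> \<phi>) (gen j) =
      inv\<^bsub>F n\<^esub> (v \<otimes>\<^bsub>F n\<^esub> f i) \<otimes>\<^bsub>F n\<^esub> gen (\<pi> j) \<otimes>\<^bsub>F n\<^esub> (v \<otimes>\<^bsub>F n\<^esub> f i)" .
  moreover have "(e \<otimes>\<^bsub>Aut (F n)\<^esub> \<phi>) (gen l) = \<phi> (gen l)" if "l \<in> {1..n}" "l \<noteq> j" for l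
    using e\<phi> other that by simp
  moreover have "e \<otimes>\<^bsub>Aut (F n)\<^esub> \<phi> \<in> carrier (Aut (F n))"
    using e conjugatingD(1)[OF conj] by simp
  moreover have "v \<otimes>\<^bsub>F n\<^esub> f i \<in> carrier (F n)" using v fi by simp
  ultimately show ?thesis by (intro conjugating_update[OF conj])
qed

definition \<epsilon>_upto :: "nat \<Rightarrow> nat \<Rightarrow> (nat letter list \<Rightarrow> nat letter list) set" where
  "\<epsilon>_upto n m = {\<epsilon> n i j |i j. i \<in> {1..m} \<and> j \<in> {1..m} \<and> i \<noteq> j}"

lemma \<epsilon>_upto_subset: "m \<le> n \<Longrightarrow> \<epsilon>_upto n m \<subseteq> carrier (Aut (F n))"
  unfolding \<epsilon>_upto_def by (auto intro!: \<epsilon>_in_Aut)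

lemma conjugating_factor:
  assumes "conjugating n \<pi> f \<phi>"
  shows "\<exists>p\<in>generate (Aut (F n)) (\<epsilon>_upto n n). \<exists>q\<in>perm_autos n. \<phi> = p \<otimes>\<^bsub>Aut (F n)\<^esub> q"
  using assms
proof (induction "\<Sum>i\<in>{1..n}. length (f i)" arbitrary: f \<phi> rule: less_induct)
  case less
  interpret A: group "Aut (F n)" by (rule group_Aut[OF group_free_group])
  have shorter: "(\<Sum>i\<in>{1..n}. length ((f(j := x)) i)) < (\<Sum>i\<in>{1..n}. length (f i))"
    if "j \<in> {1..n}" "length x < length (f j)" for j x
    using that by (intro sum_strict_mono_ex1) auto
  note \<phi> = conjugatingD(1)[OF less.prems]
  consider (first) i a u where "i \<in> {1..n}" "f i = (\<pi> i, a) # u"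
    | (peak) i j a v where "i \<in> {1..n}" "j \<in> {1..n}" "i \<noteq> j" "f j = v @ (\<pi> i, a) # f i"
    | (none) "\<And>i a u. i \<in> {1..n} \<Longrightarrow> f i \<noteq> (\<pi> i, a) # u"
        "\<And>i j a v. \<lbrakk>i \<in> {1..n}; j \<in> {1..n}; i \<noteq> j\<rbrakk> \<Longrightarrow> f j \<noteq> v @ (\<pi> i, a) # f i"
    by blast
  then show ?case
  proof cases
    case first
    have "length u < length (f i)" using first(2) by simp
    then show ?thesis
      by (rule less.hyps[OF shorter[OF first(1)] conjugating_cancel_first[OF less.prems first]])
  next
    case peak
    define e where "e = (if a then inv\<^bsub>Aut (F n)\<^esub> \<epsilon> n j i else \<epsilon> n j i)"
    have \<epsilon>: "\<epsilon> n j i \<in> carrier (Aut (F n))" "\<epsilon> n j i \<in> \<epsilon>_upto n n"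
      using \<epsilon>_in_Aut[OF peak(2,1)] peak(1-3) unfolding \<epsilon>_upto_def by blast+
    have e: "e \<in> carrier (Aut (F n))" "inv\<^bsub>Aut (F n)\<^esub> e \<in> generate (Aut (F n)) (\<epsilon>_upto n n)"
      using \<epsilon>(1) generate.incl[OF \<epsilon>(2), of "Aut (F n)"] generate.inv[OF \<epsilon>(2), of "Aut (F n)"]
      by (simp_all add: e_def)
    have "length (v \<otimes>\<^bsub>F n\<^esub> f i) < length (f j)"
      using length_mult_le[where u = v and v = "f i" and X = "{1..n}"] peak(4) by simp
    then have "\<exists>p\<in>generate (Aut (F n)) (\<epsilon>_upto n n). \<exists>q\<in>perm_autos n.
        e \<otimes>\<^bsub>Aut (F n)\<^esub> \<phi> = p \<otimes>\<^bsub>Aut (F n)\<^esub> q"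
      unfolding e_def
      by (rule less.hyps[OF shorter[OF peak(2)] conjugating_reduce_peak[OF less.prems peak]])
    then obtain p q where p: "p \<in> generate (Aut (F n)) (\<epsilon>_upto n n)" and q: "q \<in> perm_autos n"
      and eq: "e \<otimes>\<^bsub>Aut (F n)\<^esub> \<phi> = p \<otimes>\<^bsub>Aut (F n)\<^esub> q"
      by blast
    have pq: "p \<in> carrier (Aut (F n))" "q \<in> carrier (Aut (F n))"
      using A.generate_in_carrier[OF \<epsilon>_upto_subset[OF order_refl] p] q
      by (simp_all add: perm_autos_def)
    have "\<phi> = inv\<^bsub>Aut (F n)\<^esub> e \<otimes>\<^bsub>Aut (F n)\<^esub> (e \<otimes>\<^bsub>Aut (F n)\<^esub> \<phi>)"
      using e \<phi> by (simp add: A.inv_cancel)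
    also have "\<dots> = (inv\<^bsub>Aut (F n)\<^esub> e \<otimes>\<^bsub>Aut (F n)\<^esub> p) \<otimes>\<^bsub>Aut (F n)\<^esub> q"
      using e pq by (simp add: eq A.m_assoc)
    finally show ?thesis by (intro bexI[OF _ generate.eng[OF e(2) p]] bexI[OF _ q])
  next
    case none
    have "\<phi> \<in> perm_autos n" by (rule peak_free_imp_perm_auto[OF less.prems none])
    then show ?thesis using A.l_one[OF \<phi>, symmetric]
      by (intro bexI[of _ "\<one>\<^bsub>Aut (F n)\<^esub>"] bexI[of _ \<phi>] generate.one)
  qed
qed

section \<open>Subgroups normalised by generators\<close>

lemma (in group) conj_generate_closed:
  assumes S: "S \<subseteq> carrier G" and a: "a \<in> carrier G"
    and conj: "\<And>s. s \<in> S \<Longrightarrow> a \<otimes> s \<otimes> inv a \<in> generate G S"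
    and h: "h \<in> generate G S"
  shows "a \<otimes> h \<otimes> inv a \<in> generate G S"
  using h
proof (induction h rule: generate.induct)
  case one
  then show ?case using a by (simp add: generate.one)
next
  case (incl h)
  then show ?case by (rule conj)
next
  case (inv h)
  have "inv (a \<otimes> h \<otimes> inv a) \<in> generate G S"
    using generate_m_inv_closed[OF S conj[OF inv]] .
  then show ?case using a S inv by (simp add: inv_mult_group m_assoc subset_iff)
next
  case (eng h1 h2)
  have "(a \<otimes> h1 \<otimes> inv a) \<otimes> (a \<otimes> h2 \<otimes> inv a) \<in> generate G S"
    using eng.IH by (rule generate.eng)
  then show ?case
    using a generate_in_carrier[OF S] eng.hyps by (simp add: m_assoc inv_cancel)
qed

text \<open>
  Conjugation by a generator and by its inverse both have to preserve \<open>generate G S\<close>: in an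
  infinite group the one does not imply the other. The collection process is
  \<open>k\<^sub>1 h\<^sub>1 k\<^sub>2 h\<^sub>2 = k\<^sub>1 k\<^sub>2 (k\<^sub>2\<^sup>-\<^sup>1 h\<^sub>1 k\<^sub>2) h\<^sub>2\<close>.
\<close>
lemma (in group) generate_Un_factor:
  assumes T: "T \<subseteq> carrier G" and S: "S \<subseteq> carrier G"
    and conj: "\<And>t s. \<lbrakk>t \<in> T; s \<in> S\<rbrakk> \<Longrightarrow> t \<otimes> s \<otimes> inv t \<in> generate G S"
    and conj': "\<And>t s. \<lbrakk>t \<in> T; s \<in> S\<rbrakk> \<Longrightarrow> inv t \<otimes> s \<otimes> t \<in> generate G S"
    and x: "x \<in> generate G (T \<union> S)"
  shows "\<exists>k\<in>generate G T. \<exists>h\<in>generate G S. x = k \<otimes> h"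
proof -
  note carr = generate_in_carrier[OF T] generate_in_carrier[OF S]
  have norm: "inv k \<otimes> h \<otimes> k \<in> generate G S"
    if "k \<in> generate G T" "h \<in> generate G S" for k h
    using that
  proof (induction k arbitrary: h rule: generate.induct)
    case one
    then show ?case using carr by simp
  next
    case (incl t)
    then have "t \<in> carrier G" using T by auto
    then show ?case
      using conj_generate_closed[OF S, of "inv t" h] conj'[OF incl.hyps] incl.prems by simp
  next
    case (inv t)
    then have "t \<in> carrier G" using T by auto
    then show ?case
      using conj_generate_closed[OF S, of t h] conj[OF inv.hyps] inv.prems by simp
  next
    case (eng k1 k2)
    have "inv k2 \<otimes> (inv k1 \<otimes> h \<otimes> k1) \<otimes> k2 \<in> generate G S"
      using eng by blast
    then show ?case
      using eng.hyps eng.prems carr by (simp add: inv_mult_group m_assoc)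
  qed
  show ?thesis
    using x
  proof (induction x rule: generate.induct)
    case one
    then show ?case by (metis generate.one l_one one_closed)
  next
    case (incl g)
    then have "g \<in> carrier G" using T S by auto
    with incl show ?case by (metis Un_iff generate.incl generate.one l_one r_one)
  next
    case (inv g)
    then have "g \<in> carrier G" using T S by auto
    with inv show ?case by (metis Un_iff generate.inv generate.one inv_closed l_one r_one)
  next
    case (eng g1 g2)
    then obtain k1 h1 k2 h2 where
      kh: "k1 \<in> generate G T" "h1 \<in> generate G S" "k2 \<in> generate G T" "h2 \<in> generate G S"
      and eq: "g1 = k1 \<otimes> h1" "g2 = k2 \<otimes> h2" by blast
    have "g1 \<otimes> g2 = (k1 \<otimes> k2) \<otimes> ((inv k2 \<otimes> h1 \<otimes> k2) \<otimes> h2)"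
      using kh carr by (simp add: eq m_assoc inv_cancel)
    then show ?case using kh norm by (meson generate.eng)
  qed
qed

text \<open>
  If \<open>a y\<close> centralises \<open>x\<close>, then \<open>a\<close> acts on \<open>x\<close> like \<open>y\<^sup>-\<^sup>1\<close>. This is how a relation of the shape
  of \<open>\<epsilon>_diagonal_commute\<close> turns conjugation by an element outside a subgroup into
  conjugation by one inside it.
\<close>
lemma (in group) conj_eq_of_commuting_product:
  assumes carr: "a \<in> carrier G" "x \<in> carrier G" "y \<in> carrier G"
    and ay: "a \<otimes> y = y \<otimes> a" and ayx: "(a \<otimes> y) \<otimes> x = x \<otimes> (a \<otimes> y)"
  shows "a \<otimes> x \<otimes> inv a = inv y \<otimes> x \<otimes> y" and "inv a \<otimes> x \<otimes> a = y \<otimes> x \<otimes> inv y"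
proof -
  have "y \<otimes> (a \<otimes> x) = x \<otimes> y \<otimes> a" using carr ay ayx by (simp add: m_assoc)
  then have "a \<otimes> x = inv y \<otimes> x \<otimes> y \<otimes> a" 
    using carr by (metis inv_cancel(2) m_assoc m_closed inv_closed)
  then show "a \<otimes> x \<otimes> inv a = inv y \<otimes> x \<otimes> y" using carr by (simp add: m_assoc)
  have "a \<otimes> (y \<otimes> x) = x \<otimes> a \<otimes> y" using carr ayx by (simp add: m_assoc)
  then have "y \<otimes> x = inv a \<otimes> x \<otimes> a \<otimes> y"
    using carr by (metis inv_cancel(2) m_assoc m_closed inv_closed)
  then show "inv a \<otimes> x \<otimes> a = y \<otimes> x \<otimes> inv y" using carr by (simp add: m_assoc)
qed

section \<open>McCool's relations\<close>

lemma \<epsilon>_commute: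
  assumes "i \<in> {1..n}" "j \<in> {1..n}" "k \<in> {1..n}" "l \<in> {1..n}"
    and "i \<noteq> j" "k \<noteq> l" "i \<noteq> k" "i \<noteq> l" "k \<noteq> j"
  shows "\<epsilon> n i j \<otimes>\<^bsub>Aut (F n)\<^esub> \<epsilon> n k l = \<epsilon> n k l \<otimes>\<^bsub>Aut (F n)\<^esub> \<epsilon> n i j"
proof -
  interpret group "F n" by (rule group_free_group)
  interpret A: group "Aut (F n)" by (rule group_Aut[OF is_group])
  note e = \<epsilon>_in_Aut[OF assms(1,2,5)] \<epsilon>_in_Aut[OF assms(3,4,6)]
  interpret e1: group_hom "F n" "F n" "\<epsilon> n i j" by (rule Aut_group_hom[OF is_group e(1)])
  interpret e2: group_hom "F n" "F n" "\<epsilon> n k l" by (rule Aut_group_hom[OF is_group e(2)])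
  show ?thesis
  proof (rule Aut_free_group_eqI)
    fix x assume "x \<in> {1..n}"
    then show "(\<epsilon> n i j \<otimes>\<^bsub>Aut (F n)\<^esub> \<epsilon> n k l) (gen x) = (\<epsilon> n k l \<otimes>\<^bsub>Aut (F n)\<^esub> \<epsilon> n i j) (gen x)"
      using assms e by (simp add: Aut_mult_apply \<epsilon>_gen gen_closed del: atLeastAtMost_iff)
  qed (use e in simp_all)
qed

text \<open>
  On \<open>gen i\<close> and \<open>gen k\<close>, hence on the subgroup that they generate, \<open>\<epsilon> n i j\<close> followed by
  \<open>\<epsilon> n k j\<close> agrees with conjugation by \<open>gen j\<close>. Conjugating \<open>gen i\<close> by \<open>gen k\<close> takes place inside
  that subgroup and fixes \<open>gen j\<close>, so it commutes with this.
\<close>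
lemma \<epsilon>_diagonal_commute:
  assumes "i \<in> {1..n}" "j \<in> {1..n}" "k \<in> {1..n}" and "i \<noteq> j" "i \<noteq> k" "k \<noteq> j"
  shows "(\<epsilon> n i j \<otimes>\<^bsub>Aut (F n)\<^esub> \<epsilon> n k j) \<otimes>\<^bsub>Aut (F n)\<^esub> \<epsilon> n i k =
    \<epsilon> n i k \<otimes>\<^bsub>Aut (F n)\<^esub> (\<epsilon> n i j \<otimes>\<^bsub>Aut (F n)\<^esub> \<epsilon> n k j)"
proof -
  interpret group "F n" by (rule group_free_group)
  interpret A: group "Aut (F n)" by (rule group_Aut[OF is_group])
  note e = \<epsilon>_in_Aut[OF assms(1,2,4)] \<epsilon>_in_Aut[OF assms(3,2,6)] \<epsilon>_in_Aut[OF assms(1,3,5)]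
  interpret e1: group_hom "F n" "F n" "\<epsilon> n i j" by (rule Aut_group_hom[OF is_group e(1)])
  interpret e2: group_hom "F n" "F n" "\<epsilon> n k j" by (rule Aut_group_hom[OF is_group e(2)])
  interpret e3: group_hom "F n" "F n" "\<epsilon> n i k" by (rule Aut_group_hom[OF is_group e(3)])
  show ?thesis
  proof (rule Aut_free_group_eqI)
    fix x assume "x \<in> {1..n}"
    then show "((\<epsilon> n i j \<otimes>\<^bsub>Aut (F n)\<^esub> \<epsilon> n k j) \<otimes>\<^bsub>Aut (F n)\<^esub> \<epsilon> n i k) (gen x) =
        (\<epsilon> n i k \<otimes>\<^bsub>Aut (F n)\<^esub> (\<epsilon> n i j \<otimes>\<^bsub>Aut (F n)\<^esub> \<epsilon> n k j)) (gen x)"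
      using assms e
      by (simp add: Aut_mult_apply \<epsilon>_gen gen_closed inv_mult_group m_assoc inv_cancel
          del: atLeastAtMost_iff)
  qed (use e in simp_all)
qed

section \<open>The decomposition\<close>

abbreviation D_gens :: "nat \<Rightarrow> nat \<Rightarrow> (nat letter list \<Rightarrow> nat letter list) set" where
  "D_gens n i \<equiv> {\<epsilon> n (i + 1) j |j. j \<in> {1..i}} \<union> {\<epsilon> n j (i + 1) |j. j \<in> {1..i}}"

lemma D_gens_subset: "m < n \<Longrightarrow> D_gens n m \<subseteq> carrier (Aut (F n))"
  by (auto intro!: \<epsilon>_in_Aut)

lemma \<epsilon>_upto_Suc: "\<epsilon>_upto n (Suc m) = \<epsilon>_upto n m \<union> D_gens n m"
proof -
  have ins: "{1..Suc m} = insert (Suc m) {1..m}" and notin: "Suc m \<notin> {1..m}"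
    by (auto simp: atLeastAtMostSuc_conv)
  show ?thesis
  proof (intro equalityI subsetI)
    fix x assume "x \<in> \<epsilon>_upto n (Suc m)"
    then obtain i j where ij: "x = \<epsilon> n i j" "i \<in> insert (Suc m) {1..m}" "j \<in> insert (Suc m) {1..m}" "i \<noteq> j"
      unfolding \<epsilon>_upto_def ins by blast
    then consider "i \<in> {1..m}" "j \<in> {1..m}" | "i = Suc m" "j \<in> {1..m}" | "i \<in> {1..m}" "j = Suc m"
      by blast
    then show "x \<in> \<epsilon>_upto n m \<union> D_gens n m"
      using ij unfolding \<epsilon>_upto_def Suc_eq_plus1[symmetric] by cases blast+
  next
    fix x assume "x \<in> \<epsilon>_upto n m \<union> D_gens n m"
    then obtain i j where "x = \<epsilon> n i j"
      "i \<in> insert (Suc m) {1..m}" "j \<in> insert (Suc m) {1..m}" "i \<noteq> j"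
      using notin unfolding \<epsilon>_upto_def Suc_eq_plus1[symmetric] by blast
    then show "x \<in> \<epsilon>_upto n (Suc m)" unfolding \<epsilon>_upto_def ins by blast
  qed
qed

text \<open>
  With \<open>N = m + 1\<close>, a generator of \<open>D\<^sub>m\<close> sharing no index with \<open>\<epsilon>\<^sub>i\<^sub>j\<close>, or only the conjugating index
  \<open>j\<close> as in \<open>\<epsilon>\<^sub>N\<^sub>j\<close>, commutes with \<open>\<epsilon>\<^sub>i\<^sub>j\<close>. On \<open>\<epsilon>\<^sub>N\<^sub>i\<close> and \<open>\<epsilon>\<^sub>i\<^sub>N\<close> it acts like \<open>\<epsilon>\<^sub>N\<^sub>j\<^sup>-\<^sup>1\<close>, because
  \<open>\<epsilon>\<^sub>i\<^sub>j \<epsilon>\<^sub>N\<^sub>j\<close> centralises both. Finally \<open>\<epsilon>\<^sub>i\<^sub>j\<close> centralises \<open>\<epsilon>\<^sub>i\<^sub>N \<epsilon>\<^sub>j\<^sub>N\<close>, which determines its action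
  on the remaining generator \<open>\<epsilon>\<^sub>j\<^sub>N\<close> from that on \<open>\<epsilon>\<^sub>i\<^sub>N\<close>.
\<close>
lemma \<epsilon>_normalises_D:
  assumes m: "m < n" and i: "i \<in> {1..m}" and j: "j \<in> {1..m}" and ij: "i \<noteq> j"
    and s: "s \<in> D_gens n m"
  shows "\<epsilon> n i j \<otimes>\<^bsub>Aut (F n)\<^esub> s \<otimes>\<^bsub>Aut (F n)\<^esub> inv\<^bsub>Aut (F n)\<^esub> \<epsilon> n i j \<in> D n m \<and>
    inv\<^bsub>Aut (F n)\<^esub> \<epsilon> n i j \<otimes>\<^bsub>Aut (F n)\<^esub> s \<otimes>\<^bsub>Aut (F n)\<^esub> \<epsilon> n i j \<in> D n m"
    (is "?P s")
proof -
  interpret A: group "Aut (F n)" by (rule group_Aut[OF group_free_group])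
  let ?N = "m + 1"
  interpret D: subgroup "D n m" "Aut (F n)"
    unfolding D_def by (rule A.generate_is_subgroup[OF D_gens_subset[OF m]])
  have N: "?N \<in> {1..n}" and le: "k \<in> {1..n}" and neq: "k \<noteq> ?N" if "k \<in> {1..m}" for k
    using that m by auto
  have D: "\<epsilon> n ?N k \<in> D n m" "\<epsilon> n k ?N \<in> D n m" if "k \<in> {1..m}" for k
    using that unfolding D_def by (auto intro!: generate.incl)
  define a where "a = \<epsilon> n i j"
  have a: "a \<in> carrier (Aut (F n))"
    unfolding a_def using \<epsilon>_in_Aut[OF le[OF i] le[OF j] ij] .
  have commute: "?P s" if "s \<in> D n m" "a \<otimes>\<^bsub>Aut (F n)\<^esub> s = s \<otimes>\<^bsub>Aut (F n)\<^esub> a" for s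
  proof -
    have "a \<otimes>\<^bsub>Aut (F n)\<^esub> s \<otimes>\<^bsub>Aut (F n)\<^esub> inv\<^bsub>Aut (F n)\<^esub> a = s"
      using that a by (simp add: A.m_assoc)
    moreover have "inv\<^bsub>Aut (F n)\<^esub> a \<otimes>\<^bsub>Aut (F n)\<^esub> s \<otimes>\<^bsub>Aut (F n)\<^esub> a = s"
      using that a by (simp add: A.m_assoc flip: that(2)) (simp add: A.inv_cancel)
    ultimately show ?thesis using that unfolding a_def by simp
  qed
  have twisted: "?P s" if "s \<in> D n m" "y \<in> D n m"
    "a \<otimes>\<^bsub>Aut (F n)\<^esub> y = y \<otimes>\<^bsub>Aut (F n)\<^esub> a"
    "(a \<otimes>\<^bsub>Aut (F n)\<^esub> y) \<otimes>\<^bsub>Aut (F n)\<^esub> s = s \<otimes>\<^bsub>Aut (F n)\<^esub> (a \<otimes>\<^bsub>Aut (F n)\<^esub> y)" for s y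
    using A.conj_eq_of_commuting_product[OF a _ _ that(3,4)] that(1,2) unfolding a_def by simp
  have diff: "?P (inv\<^bsub>Aut (F n)\<^esub> s \<otimes>\<^bsub>Aut (F n)\<^esub> t)"
    if "s \<in> D n m" "t \<in> D n m" "?P s" "?P t" for s t
  proof -
    have "c \<otimes>\<^bsub>Aut (F n)\<^esub> (inv\<^bsub>Aut (F n)\<^esub> s \<otimes>\<^bsub>Aut (F n)\<^esub> t) \<otimes>\<^bsub>Aut (F n)\<^esub> inv\<^bsub>Aut (F n)\<^esub> c =
        inv\<^bsub>Aut (F n)\<^esub> (c \<otimes>\<^bsub>Aut (F n)\<^esub> s \<otimes>\<^bsub>Aut (F n)\<^esub> inv\<^bsub>Aut (F n)\<^esub> c) \<otimes>\<^bsub>Aut (F n)\<^esub>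
        (c \<otimes>\<^bsub>Aut (F n)\<^esub> t \<otimes>\<^bsub>Aut (F n)\<^esub> inv\<^bsub>Aut (F n)\<^esub> c)"
      if "c \<in> carrier (Aut (F n))" for c
      using that \<open>s \<in> D n m\<close> \<open>t \<in> D n m\<close>
      by (simp add: A.inv_mult_group A.m_assoc A.inv_cancel)
    from this[OF a] this[OF A.inv_closed[OF a]] show ?thesis
      using that a unfolding a_def[symmetric] by simp
  qed
  let ?y = "\<epsilon> n ?N j" and ?u = "\<epsilon> n i ?N"
  have ay: "a \<otimes>\<^bsub>Aut (F n)\<^esub> ?y = ?y \<otimes>\<^bsub>Aut (F n)\<^esub> a"
    unfolding a_def using i j ij N le neq by (intro \<epsilon>_commute) auto
  have u: "?P ?u"
    using \<epsilon>_diagonal_commute[of i n j ?N] i j ij m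
    by (intro twisted[OF D(2)[OF i] D(1)[OF j] ay]) (auto simp: a_def)
  from s consider (into) k where "k \<in> {1..m}" "s = \<epsilon> n ?N k" | (outof) k where "k \<in> {1..m}" "s = \<epsilon> n k ?N"
    by blast
  then show ?thesis
  proof cases
    case into
    show ?thesis
    proof (cases "k = i")
      case True
      have "?y \<otimes>\<^bsub>Aut (F n)\<^esub> a \<otimes>\<^bsub>Aut (F n)\<^esub> s = s \<otimes>\<^bsub>Aut (F n)\<^esub> (?y \<otimes>\<^bsub>Aut (F n)\<^esub> a)"
        using \<epsilon>_diagonal_commute[of ?N n j i] i j ij m by (auto simp: a_def into True)
      then show ?thesis
        using D into(2) True i j ay by (intro twisted[OF _ D(1)[OF j] ay]) auto
    next
      case False
      then show ?thesis
        using into i j ij m D unfolding into(2) by (intro commute D) (auto simp: a_def intro!: \<epsilon>_commute)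
    qed
  next
    case outof
    consider "k = i" | "k = j" | "k \<noteq> i" "k \<noteq> j" by blast
    then show ?thesis
    proof cases
      case 1
      then show ?thesis using u outof by simp
    next
      case 2
      have sD: "s \<in> D n m" "?u \<in> D n m" using outof D i by auto
      have us: "(?u \<otimes>\<^bsub>Aut (F n)\<^esub> s) \<otimes>\<^bsub>Aut (F n)\<^esub> a = a \<otimes>\<^bsub>Aut (F n)\<^esub> (?u \<otimes>\<^bsub>Aut (F n)\<^esub> s)"
        using \<epsilon>_diagonal_commute[of i n ?N j] i j ij m by (auto simp: a_def outof 2)
      let ?us = "?u \<otimes>\<^bsub>Aut (F n)\<^esub> s"
      have "?P ?us" using sD us by (intro commute) auto
      then have "?P (inv\<^bsub>Aut (F n)\<^esub> ?u \<otimes>\<^bsub>Aut (F n)\<^esub> ?us)"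
        using u sD by (intro diff) auto
      then show ?thesis using sD by (simp add: A.inv_cancel)
    next
      case 3
      then show ?thesis
        using outof i j ij m D unfolding outof(2) by (intro commute D) (auto simp: a_def intro!: \<epsilon>_commute)
    qed
  qed
qed

lemma foldr_mult_snoc:
  assumes "monoid G" "set xs \<subseteq> carrier G" "x \<in> carrier G"
  shows "foldr (monoid.mult G) (xs @ [x]) \<one>\<^bsub>G\<^esub> = foldr (monoid.mult G) xs \<one>\<^bsub>G\<^esub> \<otimes>\<^bsub>G\<^esub> x"
proof -
  interpret monoid G by fact
  have cl: "set xs \<subseteq> carrier G \<Longrightarrow> foldr (monoid.mult G) xs \<one>\<^bsub>G\<^esub> \<in> carrier G" for xs
    by (induction xs) auto
  show "foldr (monoid.mult G) (xs @ [x]) \<one>\<^bsub>G\<^esub> = foldr (monoid.mult G) xs \<one>\<^bsub>G\<^esub> \<otimes>\<^bsub>G\<^esub> x"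
    using assms(2) assms(3) by (induction xs) (auto simp: m_assoc cl)
qed

lemma D_subset: "m < n \<Longrightarrow> D n m \<subseteq> carrier (Aut (F n))"
  unfolding D_def
  by (intro group.generate_incl[OF group_Aut[OF group_free_group]] D_gens_subset)

lemma generate_\<epsilon>_upto_factor:
  assumes "m \<le> n" and "x \<in> generate (Aut (F n)) (\<epsilon>_upto n m)"
  shows "\<exists>b. (\<forall>j\<in>{1..<m}. b j \<in> D n j) \<and>
    x = foldr (monoid.mult (Aut (F n))) (map b [1..<m]) \<one>\<^bsub>Aut (F n)\<^esub>"
  using assms
proof (induction m arbitrary: x)
  case 0
  interpret A: group "Aut (F n)" by (rule group_Aut[OF group_free_group])
  have "x = \<one>\<^bsub>Aut (F n)\<^esub>"
    using 0(2) by (simp add: \<epsilon>_upto_def A.generate_empty)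
  then show ?case by simp
next
  case (Suc m)
  interpret A: group "Aut (F n)" by (rule group_Aut[OF group_free_group])
  have m: "m < n" using Suc.prems by simp
  have conj: "t \<otimes>\<^bsub>Aut (F n)\<^esub> s \<otimes>\<^bsub>Aut (F n)\<^esub> inv\<^bsub>Aut (F n)\<^esub> t \<in> D n m \<and>
      inv\<^bsub>Aut (F n)\<^esub> t \<otimes>\<^bsub>Aut (F n)\<^esub> s \<otimes>\<^bsub>Aut (F n)\<^esub> t \<in> D n m"
    if "t \<in> \<epsilon>_upto n m" "s \<in> D_gens n m" for t s
    using that(1) \<epsilon>_normalises_D[OF m _ _ _ that(2)] unfolding \<epsilon>_upto_def by blast
  obtain k h where k: "k \<in> generate (Aut (F n)) (\<epsilon>_upto n m)" and h: "h \<in> D n m"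
    and x: "x = k \<otimes>\<^bsub>Aut (F n)\<^esub> h"
    using A.generate_Un_factor[OF \<epsilon>_upto_subset[of m n] D_gens_subset[OF m], of x] conj Suc.prems m
    unfolding \<epsilon>_upto_Suc D_def by auto
  obtain b where b: "\<forall>j\<in>{1..<m}. b j \<in> D n j"
    and k': "k = foldr (monoid.mult (Aut (F n))) (map b [1..<m]) \<one>\<^bsub>Aut (F n)\<^esub>"
    using Suc.IH[OF _ k] m by auto
  show ?case
  proof (cases "m = 0")
    case True
    (* D n 0 is trivial, and the list of factors starts at index 1. *)
    have "h = \<one>\<^bsub>Aut (F n)\<^esub>"
      using h True by (simp add: D_def A.generate_empty)
    then show ?thesis using True k' x by auto
  next
    case False
    define c where "c = b(m := h)"
    have bc: "b j \<in> carrier (Aut (F n))" if "j \<in> {1..<m}" for j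
    proof (rule subsetD[OF D_subset])
      show "j < n" using that m by simp
      show "b j \<in> D n j" using b that by (rule bspec)
    qed
    have set: "set (map b [1..<m]) \<subseteq> carrier (Aut (F n))"
      unfolding set_map set_upt using bc by (rule image_subsetI)
    have hc: "h \<in> carrier (Aut (F n))"
      by (rule subsetD[OF D_subset[OF m] h])
    have "map c [1..<Suc m] = map b [1..<m] @ [h]"
      using False by (simp add: c_def)
    then have "x = foldr (monoid.mult (Aut (F n))) (map c [1..<Suc m]) \<one>\<^bsub>Aut (F n)\<^esub>"
      unfolding x k' by (simp only: foldr_mult_snoc[OF A.is_monoid set hc])
    moreover have "\<forall>j\<in>{1..<Suc m}. c j \<in> D n j"
    proof
      fix j assume "j \<in> {1..<Suc m}"
      then consider "j = m" | "j \<noteq> m" "j \<in> {1..<m}" by fastforce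
      then show "c j \<in> D n j" using b h by cases (simp_all add: c_def)
    qed
    ultimately show ?thesis by (intro exI[of _ c] conjI)
  qed
qed

theorem corollary3p1:
  fixes n :: nat
  assumes "n \<ge> 2"
    and "\<beta> \<in> C n"
  shows "\<exists>b \<pi>. (\<forall>j\<in>{1..n-1}. b j \<in> D n j) \<and> \<pi> \<in> perm_autos n \<and>
    \<beta> = foldr (monoid.mult (Aut (F n))) (map b [1..<n]) \<one>\<^bsub>Aut (F n)\<^esub> \<otimes>\<^bsub>Aut (F n)\<^esub> \<pi>"
proof -
  obtain \<pi> f where "conjugating n \<pi> f \<beta>"
    using assms(2) unfolding C_def conjugating_def by blast
  then obtain p q where p: "p \<in> generate (Aut (F n)) (\<epsilon>_upto n n)" and q: "q \<in> perm_autos n"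
    and \<beta>: "\<beta> = p \<otimes>\<^bsub>Aut (F n)\<^esub> q"
    using conjugating_factor by blast
  obtain b where "\<forall>j\<in>{1..<n}. b j \<in> D n j"
    and "p = foldr (monoid.mult (Aut (F n))) (map b [1..<n]) \<one>\<^bsub>Aut (F n)\<^esub>"
    using generate_\<epsilon>_upto_factor[OF order_refl p] by blast
  then show ?thesis
    using q \<beta> by (intro exI[of _ b] exI[of _ q]) auto
qed

end
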